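(* Let $\alpha \geq 2$ and $c_0>0$ be real numbers, and let $w$ be a real random variable such that $\mathbb{E} w=0$, $\mathbb{E} w^2=1$ and $$\mathbb{P}(|w|\geq t)\geq \frac{c_0}{t^{\alpha}}\qquad\text{for all real } t\geq 1.$$ Let $p\le n$ be positive integers, let $w_{ij}$ ($1\le i\le p$, $1\le j\le n$) be i.i.d. random variables with the same distribution as $w$, let $W_n=(w_{ij})$ be the corresponding $p\times n$ random matrix, and let $X_i=(w_{i1},\dots,w_{in})\in\mathbb{R}^n$, $1\le i\le p$, be the rows of $W_n$. Then, for every real $K\geq 1$, $$\mathbb{P}\left(\sup_{1\leq i\leq p}|X_i|\geq \sqrt{Kn}\right)\geq \min\left\{\frac{c_0\,p}{4\,n^{\frac{\alpha}{2}-1}K^{\frac{\alpha}{2}}},\ \frac12\right\}.$$ In particular, with $\Gamma_n=\frac1n W_nW_n^T$, $$\mathbb{P}\left(\lambda_{\max}(\Gamma_n)\geq K\right)\geq \min\left\{\frac{c_0\,p}{4\,n^{\frac{\alpha}{2}-1}K^{\frac{\alpha}{2}}},\ \frac12\right\}.$$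
   Context: $|\cdot|$ applied to a vector denotes the Euclidean norm. $\Gamma_n=\frac1n W_nW_n^T$ is the $p\times p$ sample covariance matrix, and $\lambda_{\max}(\Gamma_n)$ denotes its largest eigenvalue. *)

theory Defs
  imports "HOL-Probability.Probability"
begin

definition eigenvalue :: "real ^ 'm ^ 'm \<Rightarrow> real \<Rightarrow> bool" where
  "eigenvalue A c \<longleftrightarrow> (\<exists>v. v \<noteq> 0 \<and> A *v v = c *\<^sub>R v)"

text \<open>Only meaningful when the set of real eigenvalues is nonempty, e.g. for symmetric \<open>A\<close>.\<close>

definition lambda_max :: "real ^ 'm ^ 'm \<Rightarrow> real" where
  "lambda_max A = Max {c. eigenvalue A c}"

definition random_matrix :: "('p \<Rightarrow> 'n \<Rightarrow> 'a \<Rightarrow> real) \<Rightarrow> 'a \<Rightarrow> real ^ 'n ^ 'p" where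
  "random_matrix w \<omega> = (\<chi> i j. w i j \<omega>)"

definition sample_covariance :: "real ^ 'n ^ 'p \<Rightarrow> real ^ 'p ^ 'p" where
  "sample_covariance A = (1 / real CARD('n)) *\<^sub>R (A ** transpose A)"

end

theory Submission
  imports Defs
begin

text \<open>
  One large entry is enough.  If \<open>\<bar>w\<^sub>i\<^sub>j\<bar> \<ge> sqrt (K n)\<close> for some \<open>i, j\<close>, then the row \<open>X\<^sub>i\<close> has norm at
  least \<open>sqrt (K n)\<close>; and then the diagonal entry \<open>\<bar>X\<^sub>i\<bar>\<^sup>2 / n\<close> of \<open>\<Gamma>\<^sub>n\<close>, which is the value of the
  quadratic form of \<open>\<Gamma>\<^sub>n\<close> at a coordinate vector, is at least \<open>K\<close>.  So both events contain the event
  that some entry is large.  By the tail hypothesis at \<open>t = sqrt (K n)\<close> each of the \<open>n p\<close> independent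
  entries is large with probability at least \<open>q = c\<^sub>0 / (K n) powr (\<alpha> / 2)\<close>.  With \<open>x = n p q\<close>,
  Bernoulli's inequality bounds the probability that none is large by \<open>(1 - q) ^ (n p) \<le> 1 / (1 + x)\<close>
  (\<open>prob_exists_indep_ge\<close>), and \<open>x / (1 + x) \<ge> min (x / 4) (1 / 2)\<close>.

  The largest eigenvalue is compared with the quadratic form through the variational principle
  \<open>lambda_max_ge_iff\<close>.  The same principle makes \<open>{A. lambda_max (sample_covariance A) \<ge> K}\<close> the
  projection of a closed set along a compact sphere, hence closed; without this the event
  would not be known to be measurable and its inclusion of a likely event would say nothing
  about its probability.
\<close>

section \<open>Independent events of uniformly positive probability\<close>

lemma power_one_minus_le_inverse:
  fixes q :: real
  assumes "0 \<le> q" "q \<le> 1"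
  shows "(1 - q) ^ m \<le> 1 / (1 + real m * q)"
proof -
  have "(1 - q) ^ m * (1 + real m * q) \<le> (1 - q) ^ m * (1 + q) ^ m"
    using assms Bernoulli_inequality[of q m] by (intro mult_left_mono) auto
  also have "\<dots> = (1 - q\<^sup>2) ^ m"
    by (simp add: power_mult_distrib[symmetric] power2_eq_square algebra_simps)
  also have "\<dots> \<le> 1"
    using assms by (intro power_le_one) (auto simp: power_le_one)
  finally show ?thesis
    using assms by (simp add: pos_le_divide_eq add_pos_nonneg)
qed

text \<open>
  A union bound would give only an upper estimate; independence turns the probability that every
  \<open>X i\<close> misses its set into a product, each factor of which is at most \<open>1 - q\<close>.
\<close>

lemma (in prob_space) prob_exists_indep_ge:
  assumes indep: "indep_vars M' X I"
    and I: "finite I" "I \<noteq> {}"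
    and A: "\<And>i. i \<in> I \<Longrightarrow> A i \<in> sets (M' i)"
    and q: "0 \<le> q" "\<And>i. i \<in> I \<Longrightarrow> q \<le> prob (X i -` A i \<inter> space M)"
  shows "real (card I) * q / (1 + real (card I) * q) \<le> prob {\<omega> \<in> space M. \<exists>i\<in>I. X i \<omega> \<in> A i}"
proof -
  have X: "X i \<in> measurable M (M' i)" if "i \<in> I" for i
    using indep that by (auto simp: indep_vars_def2)
  have ev: "X i -` A i \<inter> space M \<in> events" if "i \<in> I" for i
    using X[OF that] A[OF that] by (rule measurable_sets)
  have miss: "X i -` (space (M' i) - A i) \<inter> space M = space M - (X i -` A i \<inter> space M)"
    if "i \<in> I" for i
    using X[OF that] by (auto dest: measurable_space)
  have "q \<le> 1"
    using I q(2) prob_le_1 order_trans by blast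
  have "prob (\<Inter>i\<in>I. X i -` (space (M' i) - A i) \<inter> space M)
      = (\<Prod>i\<in>I. prob (X i -` (space (M' i) - A i) \<inter> space M))"
    using indep I A by (intro indep_varsD_finite) auto
  also have "\<dots> \<le> (\<Prod>i\<in>I. 1 - q)"
    using q(2) by (intro prod_mono) (auto simp: miss prob_compl[OF ev])
  also have "\<dots> \<le> 1 / (1 + real (card I) * q)"
    using power_one_minus_le_inverse[OF q(1) \<open>q \<le> 1\<close>] by simp
  finally have none: "prob (\<Inter>i\<in>I. X i -` (space (M' i) - A i) \<inter> space M)
      \<le> 1 / (1 + real (card I) * q)" .
  have "{\<omega> \<in> space M. \<exists>i\<in>I. X i \<omega> \<in> A i} = (\<Union>i\<in>I. X i -` A i \<inter> space M)"
    by auto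
  also have "\<dots> \<in> events"
    using I(1) ev by (intro sets.finite_UN) auto
  finally have some: "{\<omega> \<in> space M. \<exists>i\<in>I. X i \<omega> \<in> A i} \<in> events" .
  have "(\<Inter>i\<in>I. X i -` (space (M' i) - A i) \<inter> space M)
      = space M - {\<omega> \<in> space M. \<exists>i\<in>I. X i \<omega> \<in> A i}"
    using I miss by auto
  then have "1 - prob {\<omega> \<in> space M. \<exists>i\<in>I. X i \<omega> \<in> A i} \<le> 1 / (1 + real (card I) * q)"
    using none prob_compl[OF some] by simp
  moreover have "real (card I) * q / (1 + real (card I) * q) = 1 - 1 / (1 + real (card I) * q)"
    using q(1) by (simp add: field_simps add_nonneg_eq_0_iff)
  ultimately show ?thesis by simp
qed

section \<open>The largest eigenvalue of a symmetric matrix\<close>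

text \<open>
  Eigenvectors of a symmetric matrix for different eigenvalues are orthogonal, so there are at most
  as many eigenvalues as dimensions.
\<close>

lemma finite_eigenvalues_symmetric:
  fixes A :: "real ^ 'm ^ 'm"
  assumes sym: "transpose A = A"
  shows "finite {c. eigenvalue A c}"
proof -
  define v where "v c = (SOME v. v \<noteq> 0 \<and> A *v v = c *\<^sub>R v)" for c
  have v: "v c \<noteq> 0" "A *v v c = c *\<^sub>R v c" if "eigenvalue A c" for c
    using someI_ex[of "\<lambda>v. v \<noteq> 0 \<and> A *v v = c *\<^sub>R v"] that
    by (auto simp: v_def eigenvalue_def)
  have orth: "v c \<bullet> v d = 0" if "eigenvalue A c" "eigenvalue A d" "c \<noteq> d" for c d
  proof -
    have "(A *v v c) \<bullet> v d = v c \<bullet> (A *v v d)"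
      using dot_lmul_matrix[of "v c" A "v d"] sym by (metis transpose_matrix_vector)
    then show ?thesis
      using that v by simp
  qed
  have inj: "inj_on v {c. eigenvalue A c}"
    using orth v(1) by (metis (mono_tags, lifting) inj_onI inner_eq_zero_iff mem_Collect_eq)
  have "pairwise orthogonal (v ` {c. eigenvalue A c})"
    using orth by (auto simp: pairwise_def orthogonal_def)
  then have "independent (v ` {c. eigenvalue A c})"
    using v(1) by (intro pairwise_orthogonal_independent) auto
  then have "finite (v ` {c. eigenvalue A c})"
    by (rule independent_imp_finite)
  then show ?thesis
    using inj finite_imageD by blast
qed

text \<open>
  First-order optimality of a maximiser \<open>x\<close> of the quadratic form on the sphere.  The form
  of \<open>B = l I - A\<close> is nonnegative and vanishes at \<open>x\<close>; moving from \<open>x\<close> a short way along \<open>- B x\<close>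
  would make it negative unless \<open>B x = 0\<close>.
\<close>

lemma eigenvector_of_maximal_quadratic_form:
  fixes A :: "real ^ 'm ^ 'm"
  assumes sym: "transpose A = A"
    and le: "\<And>y. y \<bullet> (A *v y) \<le> l * (y \<bullet> y)"
    and eq: "x \<bullet> (A *v x) = l * (x \<bullet> x)"
  shows "A *v x = l *\<^sub>R x"
proof (rule ccontr)
  define b where "b = l *\<^sub>R x - A *v x"
  define B where "B = l * (b \<bullet> b) - b \<bullet> (A *v b)"
  assume "A *v x \<noteq> l *\<^sub>R x"
  then have b: "b \<bullet> b > 0"
    by (simp add: b_def)
  have adj: "b \<bullet> (A *v x) = x \<bullet> (A *v b)"
    using dot_lmul_matrix[of b A x] sym by (metis transpose_matrix_vector inner_commute)
  have bb: "b \<bullet> b = l * (x \<bullet> b) - b \<bullet> (A *v x)"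
    by (subst (2) b_def) (simp add: inner_diff_right inner_commute)
  have quad: "2 * t * (b \<bullet> b) \<le> t\<^sup>2 * B" for t
  proof -
    have form: "(x - t *\<^sub>R b) \<bullet> (A *v (x - t *\<^sub>R b))
        = x \<bullet> (A *v x) - 2 * t * (b \<bullet> (A *v x)) + t\<^sup>2 * (b \<bullet> (A *v b))"
      by (simp add: adj power2_eq_square algebra_simps)
    have norm: "(x - t *\<^sub>R b) \<bullet> (x - t *\<^sub>R b) = x \<bullet> x - 2 * t * (x \<bullet> b) + t\<^sup>2 * (b \<bullet> b)"
      by (simp add: inner_commute power2_eq_square algebra_simps)
    have "x \<bullet> (A *v x) - 2 * t * (b \<bullet> (A *v x)) + t\<^sup>2 * (b \<bullet> (A *v b))
        \<le> l * (x \<bullet> x - 2 * t * (x \<bullet> b) + t\<^sup>2 * (b \<bullet> b))"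
      using le[of "x - t *\<^sub>R b"] unfolding form norm .
    then have "2 * t * (l * (x \<bullet> b) - b \<bullet> (A *v x)) \<le> t\<^sup>2 * B"
      using eq by (simp add: B_def algebra_simps)
    then show ?thesis
      by (simp only: bb[symmetric])
  qed
  have "B \<ge> 0"
    using le[of b] by (simp add: B_def)
  \<comment> \<open>The linear term dominates at this step length; adding \<open>1\<close> keeps it defined when \<open>B = 0\<close>.\<close>
  define t where "t = (b \<bullet> b) / (B + 1)"
  have t: "t > 0" "t * (B + 1) = b \<bullet> b"
    using b \<open>B \<ge> 0\<close> by (auto simp: t_def)
  have "t * (2 * (b \<bullet> b)) \<le> t * (t * B)"
    using quad[of t] by (simp add: power2_eq_square mult_ac)
  then have "2 * (b \<bullet> b) \<le> t * B"
    using t(1) by simp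
  then show False
    using t b by (simp add: algebra_simps)
qed

text \<open>
  The variational principle.  The form attains its maximum on the compact unit sphere,
  and the maximal value is itself an eigenvalue.
\<close>

lemma lambda_max_ge_iff:
  fixes A :: "real ^ 'm ^ 'm"
  assumes sym: "transpose A = A"
  shows "K \<le> lambda_max A \<longleftrightarrow> (\<exists>x\<in>sphere 0 1. K \<le> x \<bullet> (A *v x))"
proof -
  have "continuous_on (sphere 0 1) (\<lambda>x :: real ^ 'm. x \<bullet> (A *v x))"
    by (intro continuous_intros matrix_vector_mult_linear_continuous_on)
  moreover have "sphere (0 :: real ^ 'm) 1 \<noteq> {}"
    by (simp add: sphere_eq_empty)
  ultimately obtain x :: "real ^ 'm" where x: "x \<in> sphere 0 1"
    and max: "\<And>y. y \<in> sphere 0 1 \<Longrightarrow> y \<bullet> (A *v y) \<le> x \<bullet> (A *v x)"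
    using continuous_attains_sup[OF compact_sphere, of 0 1 "\<lambda>x. x \<bullet> (A *v x)"] by auto
  define l where "l = x \<bullet> (A *v x)"
  have xx: "x \<bullet> x = 1"
    using x by (simp add: dot_square_norm)
  have le: "y \<bullet> (A *v y) \<le> l * (y \<bullet> y)" for y
  proof (cases "y = 0")
    case False
    have "y \<bullet> (A *v y) = (norm y)\<^sup>2 * (sgn y \<bullet> (A *v sgn y))"
      using False by (simp add: sgn_div_norm matrix_vector_mult_scaleR power2_eq_square field_simps)
    also have "\<dots> \<le> (norm y)\<^sup>2 * l"
      using False max[of "sgn y"] by (intro mult_left_mono) (auto simp: l_def norm_sgn)
    finally show ?thesis
      by (simp add: dot_square_norm mult.commute)
  qed simp
  have "A *v x = l *\<^sub>R x"
    using sym le by (rule eigenvector_of_maximal_quadratic_form) (simp add: xx l_def)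
  then have l: "eigenvalue A l"
    using xx by (auto simp: eigenvalue_def intro!: exI[of _ x])
  have "c \<le> l" if c: "eigenvalue A c" for c
  proof -
    obtain v where "v \<noteq> 0" "A *v v = c *\<^sub>R v"
      using c unfolding eigenvalue_def by blast
    then show ?thesis
      using le[of v] by simp
  qed
  then have "lambda_max A = l"
    unfolding lambda_max_def using l finite_eigenvalues_symmetric[OF sym]
    by (intro Max_eqI) auto
  then show ?thesis
    using x max by (auto simp: l_def intro: order_trans)
qed

section \<open>The sample covariance matrix\<close>

lemma transpose_sample_covariance: "transpose (sample_covariance A) = sample_covariance A"
  by (simp add: sample_covariance_def transpose_scalar matrix_transpose_mul)

lemma quadratic_form_sample_covariance:
  fixes A :: "real ^ 'n ^ 'p"
  shows "x \<bullet> (sample_covariance A *v x) = (norm (x v* A))\<^sup>2 / real CARD('n)"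
proof -
  have "x \<bullet> ((A ** transpose A) *v x) = (x v* A) \<bullet> (x v* A)"
    by (simp add: dot_lmul_matrix matrix_vector_mul_assoc[symmetric])
  then show ?thesis
    by (simp add: sample_covariance_def scaleR_matrix_vector_assoc[symmetric] dot_square_norm)
qed

lemma axis_vector_matrix_mult: "axis i (1 :: real) v* A = row i A"
  by (simp add: vec_eq_iff vector_matrix_mult_def row_def axis_def mult_delta_left)

text \<open>
  A row is the value of \<open>x v* A\<close> at a coordinate vector \<open>x\<close>, and this \<open>x\<close> serves as the test vector in
  the variational principle.
\<close>

lemma lambda_max_sample_covariance_ge:
  fixes A :: "real ^ 'n ^ 'p"
  assumes "sqrt (K * real CARD('n)) \<le> norm (row i A)"
  shows "K \<le> lambda_max (sample_covariance A)"
proof -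
  have "K * real CARD('n) \<le> (norm (row i A))\<^sup>2"
    using assms by (rule sqrt_le_D)
  then have "K \<le> axis i 1 \<bullet> (sample_covariance A *v axis i 1)"
    by (simp add: quadratic_form_sample_covariance axis_vector_matrix_mult field_simps)
  moreover have "axis i 1 \<in> sphere (0 :: real ^ 'p) 1"
    by (simp add: norm_axis_1)
  ultimately show ?thesis
    unfolding lambda_max_ge_iff[OF transpose_sample_covariance] by blast
qed

text \<open>
  Projection along the compact sphere of test vectors preserves closedness, so no continuity
  of \<open>lambda_max\<close> itself has to be established.
\<close>

lemma closed_lambda_max_sample_covariance_ge:
  "closed {A :: real ^ 'n ^ 'p. K \<le> lambda_max (sample_covariance A)}"
proof -
  have cont: "continuous_on UNIV (\<lambda>z :: (real ^ 'p) \<times> (real ^ 'n ^ 'p). (norm (fst z v* snd z))\<^sup>2 / real CARD('n))"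
    unfolding vector_matrix_mult_def by (intro continuous_intros) auto
  have "closed {z :: (real ^ 'p) \<times> (real ^ 'n ^ 'p). K \<le> (norm (fst z v* snd z))\<^sup>2 / real CARD('n)}"
    by (intro closed_Collect_le continuous_on_const cont)
  from closed_compact_projection[OF compact_sphere this, of 0 1] show ?thesis
    by (simp add: lambda_max_ge_iff[OF transpose_sample_covariance]
        quadratic_form_sample_covariance Bex_def)
qed

section \<open>Events of the random matrix\<close>

lemma borel_measurable_random_matrix:
  fixes W :: "'p::finite \<Rightarrow> 'n::finite \<Rightarrow> 'a \<Rightarrow> real"
  assumes "\<And>i j. W i j \<in> borel_measurable M"
  shows "random_matrix W \<in> borel_measurable M"
  unfolding borel_measurable_euclidean_space[of "random_matrix W"]
  using assms by (auto simp: Basis_vec_def inner_axis random_matrix_def)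

theorem proposition1:
  fixes \<alpha> c\<^sub>0 K :: real
    and N :: "'b measure" and w :: "'b \<Rightarrow> real"
    and M :: "'a measure" and W :: "'p::finite \<Rightarrow> 'n::finite \<Rightarrow> 'a \<Rightarrow> real"
  assumes alpha: "\<alpha> \<ge> 2" and c0: "c\<^sub>0 > 0"
    and N: "prob_space N" and w: "w \<in> borel_measurable N"
    and mean: "integrable N w" "prob_space.expectation N w = 0"
    and var: "integrable N (\<lambda>x. (w x)\<^sup>2)" "prob_space.expectation N (\<lambda>x. (w x)\<^sup>2) = 1"
    and tail: "\<And>t. t \<ge> 1 \<Longrightarrow> prob_space.prob N {x \<in> space N. \<bar>w x\<bar> \<ge> t} \<ge> c\<^sub>0 / t powr \<alpha>"
    and M: "prob_space M"
    and pn: "CARD('p) \<le> CARD('n)"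
    and indep: "prob_space.indep_vars M (\<lambda>_. borel) (\<lambda>(i, j). W i j) UNIV"
    and ident: "\<And>i j. distr M borel (W i j) = distr N borel w"
    and K: "K \<ge> 1"
  shows "prob_space.prob M {\<omega> \<in> space M. (SUP i. norm (row i (random_matrix W \<omega>))) \<ge> sqrt (K * real CARD('n))}
           \<ge> min (c\<^sub>0 * real CARD('p) / (4 * real CARD('n) powr (\<alpha> / 2 - 1) * K powr (\<alpha> / 2))) (1 / 2)
       \<and> prob_space.prob M {\<omega> \<in> space M. lambda_max (sample_covariance (random_matrix W \<omega>)) \<ge> K}
           \<ge> min (c\<^sub>0 * real CARD('p) / (4 * real CARD('n) powr (\<alpha> / 2 - 1) * K powr (\<alpha> / 2))) (1 / 2)"
proof -
  interpret prob_space M by (rule M)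
  define n where "n = real CARD('n)"
  define p where "p = real CARD('p)"
  have n: "n \<ge> 1" and p: "p \<ge> 1"
    by (simp_all add: n_def p_def Suc_leI)
  define t where "t = sqrt (K * n)"
  define q where "q = c\<^sub>0 / t powr \<alpha>"
  define x where "x = p * n * q"
  let ?entry = "{\<omega> \<in> space M. \<exists>i j. t \<le> \<bar>W i j \<omega>\<bar>}"
  let ?row = "{\<omega> \<in> space M. t \<le> (SUP i. norm (row i (random_matrix W \<omega>)))}"
  let ?eig = "{\<omega> \<in> space M. K \<le> lambda_max (sample_covariance (random_matrix W \<omega>))}"

  have t: "t \<ge> 1"
    using K n mult_mono[of 1 K 1 n] by (simp add: t_def)
  have q: "q \<ge> 0"
    using c0 by (simp add: q_def)
  have "t powr \<alpha> = K powr (\<alpha> / 2) * n powr (\<alpha> / 2)"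
    using K n by (simp add: t_def powr_half_sqrt[symmetric] powr_powr powr_mult)
  moreover have "n powr (\<alpha> / 2) = n * n powr (\<alpha> / 2 - 1)"
    using n by (simp add: powr_diff)
  ultimately have x: "x = c\<^sub>0 * p / (n powr (\<alpha> / 2 - 1) * K powr (\<alpha> / 2))"
    using n K by (simp add: x_def q_def field_simps)

  have W: "W i j \<in> borel_measurable M" for i j
    using indep unfolding indep_vars_def2 by auto
  have tail_W: "q \<le> prob (W i j -` {y. t \<le> \<bar>y\<bar>} \<inter> space M)" for i j
  proof -
    have borel: "{y :: real. t \<le> \<bar>y\<bar>} \<in> sets borel"
      by measurable
    have "q \<le> measure N (w -` {y. t \<le> \<bar>y\<bar>} \<inter> space N)"
      using tail[OF t] by (simp add: q_def vimage_def Int_def conj_commute)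
    also have "\<dots> = measure (distr N borel w) {y. t \<le> \<bar>y\<bar>}"
      using w borel by (simp add: measure_distr)
    also have "\<dots> = measure (distr M borel (W i j)) {y. t \<le> \<bar>y\<bar>}"
      by (simp add: ident)
    also have "\<dots> = prob (W i j -` {y. t \<le> \<bar>y\<bar>} \<inter> space M)"
      using W borel by (simp add: measure_distr)
    finally show ?thesis .
  qed
  have "x / (1 + x) \<le> prob {\<omega> \<in> space M. \<exists>k\<in>UNIV. (case k of (i, j) \<Rightarrow> W i j) \<omega> \<in> {y. t \<le> \<bar>y\<bar>}}"
    using prob_exists_indep_ge[OF indep, of "\<lambda>_. {y. t \<le> \<bar>y\<bar>}" q] q tail_W
    by (auto simp: x_def n_def p_def split: prod.splits)
  then have entry: "x / (1 + x) \<le> prob ?entry"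
    by simp
  have "x \<ge> 0"
    using n p q by (simp add: x_def)
  then have "min (x / 4) (1 / 2) \<le> x / (1 + x)"
    by (cases "x \<le> 1") (auto simp: min_le_iff_disj field_simps intro!: mult_left_mono)
  with entry have bound: "min (x / 4) (1 / 2) \<le> prob ?entry"
    by linarith

  have matrix: "random_matrix W \<in> borel_measurable M"
    using W by (rule borel_measurable_random_matrix)
  have row_ge: "t \<le> (SUP i. norm (row i A)) \<longleftrightarrow> (\<exists>i. t \<le> norm (row i A))" for A :: "real ^ 'n ^ 'p"
    by (subst cSup_eq_Max) (auto simp: Max_ge_iff)
  \<comment> \<open>In terms of the matrix this is again a closed condition, as there are finitely many rows.\<close>
  have "closed (\<Union>i. {A :: real ^ 'n ^ 'p. t \<le> norm (row i A)})"
    unfolding row_def by (intro closed_UN ballI closed_Collect_le continuous_intros) auto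
  then have "closed {A :: real ^ 'n ^ 'p. \<exists>i. t \<le> norm (row i A)}"
    by (simp add: Collect_ex_eq)
  then have row_event: "?row \<in> events"
    unfolding row_ge using measurable_sets[OF matrix borel_closed]
    by (fastforce simp: vimage_def Int_def conj_commute)
  have eig_event: "?eig \<in> events"
    using measurable_sets[OF matrix borel_closed[OF closed_lambda_max_sample_covariance_ge[of K]]]
    by (simp add: vimage_def Int_def conj_commute)

  have "t \<le> norm (row i (random_matrix W \<omega>))" if "t \<le> \<bar>W i j \<omega>\<bar>" for i j \<omega>
    using component_le_norm_cart[of "row i (random_matrix W \<omega>)" j] that
    by (simp add: row_def random_matrix_def)
  then have entry_row: "?entry \<subseteq> ?row"
    unfolding row_ge by auto
  have row_eig: "?row \<subseteq> ?eig"
    unfolding row_ge using lambda_max_sample_covariance_ge by (auto simp: t_def n_def)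
  have "prob ?entry \<le> prob ?row" "prob ?row \<le> prob ?eig"
    using entry_row row_eig row_event eig_event by (auto intro: finite_measure_mono)
  with bound have "min (x / 4) (1 / 2) \<le> prob ?row \<and> min (x / 4) (1 / 2) \<le> prob ?eig"
    by linarith
  moreover have "x / 4 = c\<^sub>0 * p / (4 * n powr (\<alpha> / 2 - 1) * K powr (\<alpha> / 2))"
    by (simp add: x)
  ultimately show ?thesis
    unfolding t_def n_def p_def by simp
qed

end
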